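(* Let $\mathcal{S}$ be an $(n-1)$-spread of $\mathrm{PG}(rn-1,q)$ and let $\mathcal{T}(\mathcal{S})$ be the associated translation Sperner space. A line of $\mathcal{T}(\mathcal{S})$ is normal if and only if the corresponding $n$-dimensional subspace meets the hyperplane $H_\infty$ in a normal element of $\mathcal{S}$.
   Context: An $(n-1)$-spread of $\mathrm{PG}(N-1,q)$ is a set of $(n-1)$-dimensional subspaces partitioning the point set. An element $E$ of an $(n-1)$-spread $\mathcal{S}$ of $\mathrm{PG}(rn-1,q)$ is normal if for every $F\in\mathcal{S}\setminus\{E\}$ the $(2n-1)$-space $\langle E,F\rangle$ is partitioned by elements of $\mathcal{S}$. Construction of $\mathcal{T}(\mathcal{S})$: embed $\mathrm{PG}(rn-1,q)$ as a hyperplane $H_\infty$ of $\mathrm{PG}(rn,q)$; the points of $\mathcal{T}(\mathcal{S})$ are the points of $\mathrm{PG}(rn,q)\setminus H_\infty$, the lines are the $n$-dimensional subspaces of $\mathrm{PG}(rn,q)$ meeting $H_\infty$ exactly in an element of $\mathcal{S}$ (a line is identified with its set of affine points), incidence is containment; the parallel classes are the sets of such $n$-spaces through a given element of $\mathcal{S}$. In an incidence structure $(\mathcal{P},\mathcal{L})$ of this kind (a $2$-$(v,k,1)$ design with parallelism, $k=q^n$), the linear manifold of a point set $\mathcal{P}'$ is the smallest $\mathcal{M}\supseteq\mathcal{P}'$ such that for any two distinct points $A,B\in\mathcal{M}$ all points of the line through $A,B$ lie in $\mathcal{M}$, with the induced incidence structure (points of $\mathcal{M}$, lines of $\mathcal{L}$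 contained in $\mathcal{M}$). A pseudo-plane is the linear manifold of three non-collinear points. A pseudo-plane is an affine plane if it is a $2$-$(k^2,k,1)$ design, i.e. has $k^2$ points. A line $\ell$ is normal if every pseudo-plane containing $\ell$ is an affine plane.
   Formalization: Proved for q > 2 only (the equivalence fails for q = 2 in general), and "every pseudo-plane containing the line" is read as every pseudo-plane spanned by two points of the line and a point off it, since the literal containment reading makes the "if" direction false. *)

theory Defs
  imports "HOL-Analysis.Cartesian_Space" "HOL-Library.Disjoint_Sets"
begin

text \<open>
  Projective spaces over a finite field are handled through the linear subspaces of the coordinate
  space \<open>'a ^ 'd\<close>, with \<open>vec.subspace\<close>, \<open>vec.dim\<close>, \<open>vec.span\<close> taken over the field \<open>'a\<close>, so that
  \<open>q = CARD('a)\<close>. The dimension \<open>k\<close> below is projective, one less than the linear dimension.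
\<close>

definition pg_subspaces :: "nat \<Rightarrow> ('a::field ^ 'd) set \<Rightarrow> ('a ^ 'd) set set" where
  "pg_subspaces k W = {U. vec.subspace U \<and> U \<subseteq> W \<and> vec.dim U = Suc k}"

abbreviation pg_points :: "('a::field ^ 'd) set \<Rightarrow> ('a ^ 'd) set set" where
  "pg_points \<equiv> pg_subspaces 0"

definition pg_partition :: "('a::field ^ 'd) set \<Rightarrow> ('a ^ 'd) set set \<Rightarrow> bool" where
  "pg_partition W T \<longleftrightarrow> partition_on (pg_points W) (pg_points ` T)"

definition pg_spread :: "nat \<Rightarrow> ('a::field ^ 'd) set \<Rightarrow> ('a ^ 'd) set set \<Rightarrow> bool" where
  "pg_spread k H S \<longleftrightarrow> S \<subseteq> pg_subspaces k H \<and> pg_partition H S"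

definition normal_element :: "('a::field ^ 'd) set set \<Rightarrow> ('a ^ 'd) set \<Rightarrow> bool" where
  "normal_element S E \<longleftrightarrow>
     E \<in> S \<and> (\<forall>F \<in> S - {E}. \<exists>T \<subseteq> S. pg_partition (vec.span (E \<union> F)) T)"

text \<open>
  The translation Sperner space of a spread \<open>S\<close> of the hyperplane \<open>H\<close>. Its points are one-dimensional
  linear subspaces not contained in \<open>H\<close>.
\<close>

definition ts_points :: "('a::field ^ 'd) set \<Rightarrow> ('a ^ 'd) set set" where
  "ts_points H = pg_points UNIV - pg_points H"

definition ts_spaces ::
    "nat \<Rightarrow> ('a::field ^ 'd) set \<Rightarrow> ('a ^ 'd) set set \<Rightarrow> ('a ^ 'd) set set" where
  "ts_spaces n H S = {U \<in> pg_subspaces n UNIV. U \<inter> H \<in> S}"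

definition ts_line :: "('a::field ^ 'd) set \<Rightarrow> ('a ^ 'd) set \<Rightarrow> ('a ^ 'd) set set" where
  "ts_line H U = {P \<in> ts_points H. P \<subseteq> U}"

definition ts_lines ::
    "nat \<Rightarrow> ('a::field ^ 'd) set \<Rightarrow> ('a ^ 'd) set set \<Rightarrow> ('a ^ 'd) set set set" where
  "ts_lines n H S = ts_line H ` ts_spaces n H S"

definition block_design :: "'p set \<Rightarrow> 'p set set \<Rightarrow> nat \<Rightarrow> nat \<Rightarrow> nat \<Rightarrow> bool" where
  "block_design P L v k l \<longleftrightarrow>
     finite P \<and> card P = v \<and> (\<forall>b \<in> L. b \<subseteq> P \<and> card b = k) \<and>
     (\<forall>A \<in> P. \<forall>B \<in> P. A \<noteq> B \<longrightarrow> card {b \<in> L. A \<in> b \<and> B \<in> b} = l)"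

definition collinear_in :: "'p set set \<Rightarrow> 'p set \<Rightarrow> bool" where
  "collinear_in L X \<longleftrightarrow> (\<exists>b \<in> L. X \<subseteq> b)"

definition line_closed :: "'p set set \<Rightarrow> 'p set \<Rightarrow> bool" where
  "line_closed L M \<longleftrightarrow>
     (\<forall>A \<in> M. \<forall>B \<in> M. A \<noteq> B \<longrightarrow> (\<forall>b \<in> L. A \<in> b \<and> B \<in> b \<longrightarrow> b \<subseteq> M))"

definition linear_manifold :: "'p set set \<Rightarrow> 'p set \<Rightarrow> 'p set" where
  "linear_manifold L X = line_closed L hull X"

definition induced_lines :: "'p set set \<Rightarrow> 'p set \<Rightarrow> 'p set set" where
  "induced_lines L M = {b \<in> L. b \<subseteq> M}"

text \<open>
  The pseudo-planes relevant to the normality of a line \<open>b\<close> are those determined by \<open>b\<close> and a point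
  off \<open>b\<close>, i.e. linear manifolds of three non-collinear points two of which lie on \<open>b\<close>. This is
  stronger than containing \<open>b\<close> as a point set: if \<open>S\<close> is a non-Desarguesian spread with a normal
  element, a triangle elsewhere may have the whole translation Sperner space as its linear manifold,
  and that manifold contains every line.
\<close>

definition pseudo_plane_through :: "'p set \<Rightarrow> 'p set set \<Rightarrow> 'p set \<Rightarrow> 'p set \<Rightarrow> bool" where
  "pseudo_plane_through P L b M \<longleftrightarrow>
     (\<exists>A B C. A \<in> b \<and> B \<in> b \<and> A \<noteq> B \<and> C \<in> P \<and> \<not> collinear_in L {A, B, C} \<and>
        M = linear_manifold L {A, B, C})"

definition is_affine_plane :: "nat \<Rightarrow> 'p set set \<Rightarrow> 'p set \<Rightarrow> bool" where
  "is_affine_plane k L M \<longleftrightarrow> block_design M (induced_lines L M) (k\<^sup>2) k 1"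

definition normal_line :: "nat \<Rightarrow> 'p set \<Rightarrow> 'p set set \<Rightarrow> 'p set \<Rightarrow> bool" where
  "normal_line k P L b \<longleftrightarrow>
     b \<in> L \<and> (\<forall>M. pseudo_plane_through P L b M \<longrightarrow> is_affine_plane k L M)"

end

theory Submission
  imports Defs
begin

text \<open>
  Fix a vector \<open>w\<close> outside \<open>H\<close>. The map \<open>h \<mapsto> span {w + h}\<close> identifies \<open>H\<close> with the points of the
  translation Sperner space, and the lines become the cosets \<open>h + E\<close> with \<open>h \<in> H\<close> and \<open>E \<in> S\<close>.
  As \<open>q > 2\<close>, a nonempty line-closed set is a coset of a linear subspace that is a union of spread
  elements. Hence the pseudo-plane of \<open>a\<close>, \<open>a + e\<close>, \<open>a + f\<close> with \<open>e \<in> E\<close>, \<open>f \<in> F\<close> is the coset at \<open>a\<close>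
  of the smallest such subspace containing \<open>E + F\<close>, and it has \<open>q\<^sup>2\<^sup>n\<close> points iff this subspace is
  \<open>E + F\<close> itself, that is, iff \<open>E + F\<close> is partitioned by spread elements.
\<close>

section \<open>Transport of normality along injections\<close>

lemma inj_on_image_subset_iff:
  assumes "inj_on f P" "A \<subseteq> P" "B \<subseteq> P"
  shows "f ` A \<subseteq> f ` B \<longleftrightarrow> A \<subseteq> B"
  using inj_on_image_mem_iff[OF assms(1) _ assms(3)] assms(2) by blast

lemma line_closed_image:
  assumes inj: "inj_on f P" and L: "L \<subseteq> Pow P" and M: "M \<subseteq> P"
  shows "line_closed ((`) f ` L) (f ` M) \<longleftrightarrow> line_closed L M"
proof -
  have mem: "f x \<in> f ` Y \<longleftrightarrow> x \<in> Y" if "x \<in> P" "Y \<subseteq> P" for x Y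
    using inj_on_image_mem_iff[OF inj that] .
  have sub: "f ` b \<subseteq> f ` M \<longleftrightarrow> b \<subseteq> M" if "b \<in> L" for b
    using inj_on_image_subset_iff[OF inj _ M] that L by blast
  have neq: "f A \<noteq> f B \<longleftrightarrow> A \<noteq> B" if "A \<in> M" "B \<in> M" for A B
    using inj_on_eq_iff[OF inj] that M by blast
  show ?thesis
    unfolding line_closed_def ball_simps
    by (intro ball_cong refl) (use mem sub neq L M in \<open>auto simp: subset_iff\<close>)
qed

lemma linear_manifold_subset:
  assumes "L \<subseteq> Pow P" "X \<subseteq> P"
  shows "linear_manifold L X \<subseteq> P"
  unfolding linear_manifold_def
  by (rule hull_minimal) (use assms in \<open>auto simp: line_closed_def\<close>)

lemma line_closed_linear_manifold: "line_closed L (linear_manifold L X)"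
  unfolding linear_manifold_def
  by (rule hull_in) (fastforce simp: line_closed_def)

lemma linear_manifold_image:
  assumes inj: "inj_on f P" and L: "L \<subseteq> Pow P" and X: "X \<subseteq> P"
  shows "linear_manifold ((`) f ` L) (f ` X) = f ` linear_manifold L X"
proof (rule antisym)
  have "line_closed ((`) f ` L) (f ` linear_manifold L X)"
    using line_closed_image[OF inj L linear_manifold_subset[OF L X]] line_closed_linear_manifold
    by blast
  then show "linear_manifold ((`) f ` L) (f ` X) \<subseteq> f ` linear_manifold L X"
    unfolding linear_manifold_def by (intro hull_minimal image_mono hull_subset)
next
  let ?N = "linear_manifold ((`) f ` L) (f ` X)"
  have N: "?N \<subseteq> f ` P"
    by (rule linear_manifold_subset) (use L X in auto)
  define M where "M = {x \<in> P. f x \<in> ?N}"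
  have M: "M \<subseteq> P" "f ` M = ?N"
    using N by (auto simp: M_def)
  have "line_closed L M"
    using line_closed_image[OF inj L M(1)] M(2) line_closed_linear_manifold[of "(`) f ` L"] by simp
  moreover have "X \<subseteq> M"
    using X hull_subset[of "f ` X" "line_closed ((`) f ` L)"]
    by (auto simp: M_def linear_manifold_def)
  ultimately have "linear_manifold L X \<subseteq> M"
    unfolding linear_manifold_def by (intro hull_minimal)
  then show "f ` linear_manifold L X \<subseteq> ?N"
    using M(2) by blast
qed

lemma collinear_in_image:
  assumes "inj_on f P" "L \<subseteq> Pow P" "X \<subseteq> P"
  shows "collinear_in ((`) f ` L) (f ` X) \<longleftrightarrow> collinear_in L X"
  unfolding collinear_in_def bex_simps
  by (intro bex_cong refl inj_on_image_subset_iff[OF assms(1,3)]) (use assms(2) in blast)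

lemma is_affine_plane_image:
  assumes inj: "inj_on f P" and L: "L \<subseteq> Pow P" and M: "M \<subseteq> P"
  shows "is_affine_plane k ((`) f ` L) (f ` M) \<longleftrightarrow> is_affine_plane k L M"
proof -
  have injM: "inj_on f M" using inj M inj_on_subset by blast
  have "f ` b \<subseteq> f ` M \<longleftrightarrow> b \<subseteq> M" if "b \<in> L" for b
    using inj_on_image_subset_iff[OF inj _ M] that L by blast
  then have ind: "induced_lines ((`) f ` L) (f ` M) = (`) f ` induced_lines L M"
    unfolding induced_lines_def by blast
  have fin: "finite (f ` M) \<longleftrightarrow> finite M"
    using injM by (rule finite_image_iff)
  have card: "card (f ` b) = card b" if "b \<in> induced_lines L M" for b
    by (rule card_image) (use that injM inj_on_subset in \<open>auto simp: induced_lines_def\<close>)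
  have through: "card {b \<in> (`) f ` induced_lines L M. f A \<in> b \<and> f B \<in> b}
      = card {b \<in> induced_lines L M. A \<in> b \<and> B \<in> b}" if AB: "A \<in> M" "B \<in> M" for A B
  proof -
    have mem: "f x \<in> f ` b \<longleftrightarrow> x \<in> b" if "x \<in> M" "b \<in> induced_lines L M" for x b
      using inj_on_image_mem_iff[OF injM] that by (auto simp: induced_lines_def)
    have "{b \<in> (`) f ` induced_lines L M. f A \<in> b \<and> f B \<in> b}
        = (`) f ` {b \<in> induced_lines L M. A \<in> b \<and> B \<in> b}"
      using mem AB by auto
    moreover have "inj_on ((`) f) {b \<in> induced_lines L M. A \<in> b \<and> B \<in> b}"
      by (rule inj_on_subset[OF inj_on_image_Pow[OF injM]]) (auto simp: induced_lines_def)
    ultimately show ?thesis by (simp add: card_image)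
  qed
  have pairs: "(\<forall>A \<in> f ` M. \<forall>B \<in> f ` M. A \<noteq> B \<longrightarrow>
        card {b \<in> (`) f ` induced_lines L M. A \<in> b \<and> B \<in> b} = 1) \<longleftrightarrow>
      (\<forall>A \<in> M. \<forall>B \<in> M. A \<noteq> B \<longrightarrow> card {b \<in> induced_lines L M. A \<in> b \<and> B \<in> b} = 1)"
    unfolding ball_simps
    by (intro ball_cong refl) (simp add: through inj_on_eq_iff[OF injM])
  have blocks: "(\<forall>b \<in> (`) f ` induced_lines L M. b \<subseteq> f ` M \<and> card b = k) \<longleftrightarrow>
      (\<forall>b \<in> induced_lines L M. b \<subseteq> M \<and> card b = k)"
    using card by (auto simp: induced_lines_def)
  show ?thesis
    unfolding is_affine_plane_def block_design_def ind pairs blocks fin card_image[OF injM] ..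
qed

lemma normal_line_image:
  assumes inj: "inj_on f P" and L: "L \<subseteq> Pow P" and b: "b \<in> L"
  shows "normal_line k (f ` P) ((`) f ` L) (f ` b) \<longleftrightarrow> normal_line k P L b"
proof -
  have bP: "b \<subseteq> P" using L b by blast
  have "(\<forall>M. pseudo_plane_through (f ` P) ((`) f ` L) (f ` b) M \<longrightarrow>
          is_affine_plane k ((`) f ` L) M) \<longleftrightarrow>
        (\<forall>A \<in> b. \<forall>B \<in> b. \<forall>C \<in> P. f A \<noteq> f B \<longrightarrow> \<not> collinear_in ((`) f ` L) (f ` {A, B, C}) \<longrightarrow>
          is_affine_plane k ((`) f ` L) (linear_manifold ((`) f ` L) (f ` {A, B, C})))"
    by (auto simp: pseudo_plane_through_def)
  also have "\<dots> \<longleftrightarrow>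
        (\<forall>A \<in> b. \<forall>B \<in> b. \<forall>C \<in> P. A \<noteq> B \<longrightarrow> \<not> collinear_in L {A, B, C} \<longrightarrow>
          is_affine_plane k L (linear_manifold L {A, B, C}))"
  proof (intro ball_cong refl)
    fix A B C assume "A \<in> b" "B \<in> b" "C \<in> P"
    then have X: "{A, B, C} \<subseteq> P" using bP by auto
    then have "f A \<noteq> f B \<longleftrightarrow> A \<noteq> B" using inj_on_eq_iff[OF inj] by simp
    then show "(f A \<noteq> f B \<longrightarrow> \<not> collinear_in ((`) f ` L) (f ` {A, B, C}) \<longrightarrow>
          is_affine_plane k ((`) f ` L) (linear_manifold ((`) f ` L) (f ` {A, B, C}))) \<longleftrightarrow>
        (A \<noteq> B \<longrightarrow> \<not> collinear_in L {A, B, C} \<longrightarrow>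
          is_affine_plane k L (linear_manifold L {A, B, C}))"
      using collinear_in_image[OF inj L X] linear_manifold_image[OF inj L X]
        is_affine_plane_image[OF inj L linear_manifold_subset[OF L X]] by simp
  qed
  also have "\<dots> \<longleftrightarrow> (\<forall>M. pseudo_plane_through P L b M \<longrightarrow> is_affine_plane k L M)"
    by (auto simp: pseudo_plane_through_def)
  finally show ?thesis
    using b by (simp add: normal_line_def)
qed

section \<open>Subspaces of a finite coordinate space\<close>

lemma card_span_independent:
  fixes B :: "('a::{field,finite} ^ 'd) set"
  assumes "vec.independent B"
  shows "card (vec.span B) = CARD('a) ^ card B"
  using vec.finiteI_independent[OF assms] assms
proof (induction B rule: finite_induct)
  case empty
  then show ?case by simp
next
  case (insert b B)
  have b: "b \<notin> vec.span B" and B: "vec.independent B"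
    using insert.prems insert.hyps by (auto simp: vec.independent_insert)
  let ?g = "\<lambda>(c, x). c *s b + x"
  have "vec.span (insert b B) = ?g ` (UNIV \<times> vec.span B)"
  proof (intro set_eqI iffI)
    fix x assume "x \<in> vec.span (insert b B)"
    then obtain c where c: "x - c *s b \<in> vec.span B"
      by (auto simp: vec.span_insert)
    then have "x = ?g (c, x - c *s b)" by simp
    then show "x \<in> ?g ` (UNIV \<times> vec.span B)" using c by blast
  next
    fix x assume "x \<in> ?g ` (UNIV \<times> vec.span B)"
    then obtain c y where "x = c *s b + y" "y \<in> vec.span B" by auto
    then have "x - c *s b \<in> vec.span B" by simp
    then show "x \<in> vec.span (insert b B)"
      unfolding vec.span_breakdown_eq ..
  qed
  moreover have "inj_on ?g (UNIV \<times> vec.span B)"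
  proof (intro inj_onI, clarify)
    fix c x c' x'
    assume x: "x \<in> vec.span B" "x' \<in> vec.span B" and eq: "c *s b + x = c' *s b + x'"
    then have "(c - c') *s b = x' - x"
      by (simp add: vec.scale_left_diff_distrib algebra_simps)
    then have "(c - c') *s b \<in> vec.span B" using x by (simp add: vec.span_diff)
    then have "c = c'"
      using b vec.span_scale[of "(c - c') *s b" B "inverse (c - c')"]
      by (cases "c = c'") auto
    then show "c = c' \<and> x = x'" using eq by simp
  qed
  ultimately show ?case
    using insert by (simp add: card_image card_cartesian_product B)
qed

lemma card_subspace:
  fixes W :: "('a::{field,finite} ^ 'd) set"
  assumes "vec.subspace W"
  shows "card W = CARD('a) ^ vec.dim W"
  by (metis assms card_span_independent vec.basis_exists vec.span_subspace)

lemma pg_points_eq: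
  fixes W :: "('a::field ^ 'd) set"
  assumes W: "vec.subspace W"
  shows "pg_points W = (\<lambda>x. vec.span {x}) ` (W - {0})"
proof (intro set_eqI iffI)
  fix P assume "P \<in> pg_points W"
  then have P: "vec.subspace P" "P \<subseteq> W" "vec.dim P = 1"
    by (auto simp: pg_subspaces_def)
  obtain B where B: "B \<subseteq> P" "vec.independent B" "P \<subseteq> vec.span B" "card B = vec.dim P"
    using vec.basis_exists by blast
  then obtain x where x: "B = {x}" using P(3) card_1_singletonE by metis
  then have "x \<noteq> 0" "P = vec.span {x}"
    using B P(1) vec.span_minimal[of "{x}" P] by auto
  then show "P \<in> (\<lambda>x. vec.span {x}) ` (W - {0})"
    using x B(1) P(2) by blast
next
  fix P assume "P \<in> (\<lambda>x. vec.span {x}) ` (W - {0})"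
  then obtain x where "x \<in> W" "x \<noteq> 0" "P = vec.span {x}" by auto
  then show "P \<in> pg_points W"
    using W vec.span_minimal[of "{x}" W] vec.dim_eq_card_independent[of "{x}"]
    by (auto simp: pg_subspaces_def)
qed

lemma span_singleton_in_pg_points_iff:
  assumes "vec.subspace W" "x \<noteq> 0"
  shows "vec.span {x} \<in> pg_points W \<longleftrightarrow> x \<in> W"
proof
  assume "vec.span {x} \<in> pg_points W"
  then show "x \<in> W" using vec.span_base[of x "{x}"] by (auto simp: pg_subspaces_def)
next
  assume "x \<in> W"
  then show "vec.span {x} \<in> pg_points W" using assms by (auto simp: pg_points_eq)
qed

lemma pg_partition_iff:
  assumes W: "vec.subspace W" and T: "\<And>G. G \<in> T \<Longrightarrow> vec.subspace G \<and> G \<noteq> {0}"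
  shows "pg_partition W T \<longleftrightarrow>
    \<Union>T \<subseteq> W \<and> (\<forall>x \<in> W. x \<noteq> 0 \<longrightarrow> (\<exists>!G. G \<in> T \<and> x \<in> G))"
    (is "_ \<longleftrightarrow> ?R")
proof
  assume p: "pg_partition W T"
  have mem: "x \<in> G \<longleftrightarrow> vec.span {x} \<in> pg_points G" if "G \<in> T" "x \<noteq> 0" for x G
    using span_singleton_in_pg_points_iff that T by blast
  have un: "(\<Union>G\<in>T. pg_points G) = pg_points W" and dj: "disjoint (pg_points ` T)"
    using p by (auto simp: pg_partition_def partition_on_def)
  have "x \<in> W" if "x \<in> G" "G \<in> T" for x G
  proof (cases "x = 0")
    case True
    then show ?thesis using W vec.subspace_0 by blast
  next
    case False
    then have "vec.span {x} \<in> pg_points W" using un mem that by blast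
    then show ?thesis using span_singleton_in_pg_points_iff[OF W False] by simp
  qed
  moreover have "\<exists>!G. G \<in> T \<and> x \<in> G" if x: "x \<in> W" "x \<noteq> 0" for x
  proof (rule ex_ex1I)
    show "\<exists>G. G \<in> T \<and> x \<in> G"
      using un mem[OF _ x(2)] span_singleton_in_pg_points_iff[OF W x(2)] x(1) by blast
  next
    fix G G' assume G: "G \<in> T \<and> x \<in> G" "G' \<in> T \<and> x \<in> G'"
    then have "vec.span {x} \<in> pg_points G \<inter> pg_points G'" using mem x by blast
    then have eq: "pg_points G = pg_points G'"
      using dj G by (auto simp: disjoint_def)
    have "y \<in> G \<longleftrightarrow> y \<in> G'" for y
      using mem[of G y] mem[of G' y] G eq T vec.subspace_0 by (cases "y = 0") auto
    then show "G = G'" by blast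
  qed
  ultimately show ?R by blast
next
  assume R: ?R
  have W': "pg_points W = (\<lambda>x. vec.span {x}) ` (W - {0})" using pg_points_eq[OF W] .
  have G': "pg_points G = (\<lambda>x. vec.span {x}) ` (G - {0})" if "G \<in> T" for G
    using pg_points_eq T that by blast
  have "(\<Union>G\<in>T. pg_points G) = (\<lambda>x. vec.span {x}) ` (\<Union>G\<in>T. G - {0})"
    unfolding image_UN using G' by (rule SUP_cong[OF refl])
  also have "(\<Union>G\<in>T. G - {0}) = W - {0}" using R by blast
  finally have "(\<Union>G\<in>T. pg_points G) = pg_points W" using W' by simp
  moreover have "disjoint (pg_points ` T)"
  proof (intro disjointI, clarify)
    fix G G' assume G: "G \<in> T" "G' \<in> T" "pg_points G \<noteq> pg_points G'"
    {
      fix P assume P: "P \<in> pg_points G \<inter> pg_points G'"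
      then obtain x where x: "x \<in> G" "x \<noteq> 0" "P = vec.span {x}" using G' G by auto
      then have "x \<in> G'" using P G T span_singleton_in_pg_points_iff[of G' x] by auto
      then have "G = G'" using R x G by blast
    }
    then show "pg_points G \<inter> pg_points G' = {}" using G by blast
  qed
  moreover have "{} \<notin> pg_points ` T"
  proof
    assume "{} \<in> pg_points ` T"
    then obtain G where G: "G \<in> T" "pg_points G = {}" by auto
    then have "G \<subseteq> {0}" using G' by blast
    moreover have "0 \<in> G" using T G vec.subspace_0 by blast
    ultimately show False using T[OF G(1)] by blast
  qed
  ultimately show "pg_partition W T"
    by (simp add: pg_partition_def partition_on_def)
qed

lemma mem_translate_iff:
  fixes x a :: "'a::ab_group_add"
  shows "x \<in> (+) a ` W \<longleftrightarrow> x - a \<in> W"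
proof
  assume "x - a \<in> W"
  then have "a + (x - a) \<in> (+) a ` W" by (rule imageI)
  then show "x \<in> (+) a ` W" by simp
qed auto

lemma coset_eq:
  assumes "vec.subspace E" "a \<in> (+) h ` E"
  shows "(+) h ` E = (+) a ` E"
proof (intro set_eqI)
  fix x
  have a: "a - h \<in> E" using assms(2) by (simp add: mem_translate_iff)
  have "x - h \<in> E \<longleftrightarrow> x - a \<in> E"
    using vec.subspace_add[OF assms(1) _ a, of "x - a"]
      vec.subspace_diff[OF assms(1) _ a, of "x - h"] by (auto simp: algebra_simps)
  then show "x \<in> (+) h ` E \<longleftrightarrow> x \<in> (+) a ` E" by (simp add: mem_translate_iff)
qed

section \<open>The coset geometry of a spread\<close>

locale vector_spread =
  fixes H :: "('a::{field,finite} ^ 'd) set" and S :: "('a ^ 'd) set set" and n :: nat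
  assumes subspace_H: "vec.subspace H"
    and subspace_spread: "E \<in> S \<Longrightarrow> vec.subspace E"
    and spread_subset: "E \<in> S \<Longrightarrow> E \<subseteq> H"
    and dim_spread: "E \<in> S \<Longrightarrow> vec.dim E = n"
    and dim_pos: "0 < n"
    and spread_cover: "x \<in> H \<Longrightarrow> x \<noteq> 0 \<Longrightarrow> \<exists>E \<in> S. x \<in> E"
    and spread_unique: "E \<in> S \<Longrightarrow> F \<in> S \<Longrightarrow> x \<in> E \<Longrightarrow> x \<in> F \<Longrightarrow> x \<noteq> 0 \<Longrightarrow> E = F"
begin

definition cosets :: "('a ^ 'd) set set" where
  "cosets = {(+) h ` E | h E. h \<in> H \<and> E \<in> S}"

definition saturated :: "('a ^ 'd) set \<Rightarrow> bool" where
  "saturated W \<longleftrightarrow> (\<forall>x \<in> W. \<forall>E \<in> S. x \<noteq> 0 \<longrightarrow> x \<in> E \<longrightarrow> E \<subseteq> W)"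

lemma card_spread: "E \<in> S \<Longrightarrow> card E = CARD('a) ^ n"
  using card_subspace subspace_spread dim_spread by metis

lemma spread_nonzero:
  assumes "E \<in> S"
  obtains x where "x \<in> E" "x \<noteq> 0"
proof -
  have "E \<noteq> {0}" using dim_spread[OF assms] dim_pos by auto
  moreover have "0 \<in> E" using assms subspace_spread vec.subspace_0 by blast
  ultimately show ?thesis using that by blast
qed

lemma cosets_subset: "cosets \<subseteq> Pow H"
proof (clarsimp simp: cosets_def)
  fix h E x assume "h \<in> H" "E \<in> S" "x \<in> E"
  then show "h + x \<in> H" using spread_subset vec.subspace_add[OF subspace_H] by blast
qed

lemma coset_through_iff:
  assumes "a \<in> H"
  shows "b \<in> cosets \<and> a \<in> b \<longleftrightarrow> (\<exists>E \<in> S. b = (+) a ` E)"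
proof
  assume "b \<in> cosets \<and> a \<in> b"
  then obtain h E where "E \<in> S" "b = (+) h ` E" "a \<in> b" unfolding cosets_def by blast
  then show "\<exists>E \<in> S. b = (+) a ` E"
    using coset_eq[OF subspace_spread] by blast
next
  assume "\<exists>E \<in> S. b = (+) a ` E"
  then obtain E where E: "E \<in> S" "b = (+) a ` E" by blast
  then have "a \<in> b" using vec.subspace_0[OF subspace_spread] by (simp add: mem_translate_iff)
  then show "b \<in> cosets \<and> a \<in> b" using assms E unfolding cosets_def by blast
qed

lemma line_closed_translate:
  assumes a: "a \<in> H" and W: "vec.subspace W" "W \<subseteq> H" "saturated W"
  shows "line_closed cosets ((+) a ` W)"
  unfolding line_closed_def
proof (intro ballI impI allI)
  fix A B b
  assume A: "A \<in> (+) a ` W" and B: "B \<in> (+) a ` W" and "A \<noteq> B" and b: "b \<in> cosets" "A \<in> b \<and> B \<in> b"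
  have "A \<in> H" using A a W subspace_H vec.subspace_add by blast
  then obtain E where E: "E \<in> S" "b = (+) A ` E" using coset_through_iff b by blast
  have eq: "(+) a ` W = (+) A ` W" using coset_eq[OF W(1) A] .
  then have "B - A \<in> W" using B by (simp add: mem_translate_iff)
  moreover have "B - A \<in> E" using b E by (simp add: mem_translate_iff)
  ultimately have "E \<subseteq> W" using W(3) \<open>A \<noteq> B\<close> E(1) by (auto simp: saturated_def)
  then show "b \<subseteq> (+) a ` W" using E eq by auto
qed

lemma line_closed_scale_diff:
  assumes M: "M \<subseteq> H" "line_closed cosets M" and xy: "x \<in> M" "y \<in> M"
  shows "x + c *s (y - x) \<in> M"
proof (cases "x = y")
  case True
  then show ?thesis using xy by simp
next
  case False
  have "y - x \<in> H" using xy M subspace_H vec.subspace_diff by blast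
  then obtain E where E: "E \<in> S" "y - x \<in> E" using spread_cover[of "y - x"] False by auto
  then have "(+) x ` E \<in> cosets" "x \<in> (+) x ` E" "y \<in> (+) x ` E"
    using coset_through_iff[of x "(+) x ` E"] xy M(1) by (auto simp: mem_translate_iff)
  then have "(+) x ` E \<subseteq> M" using M(2) xy False unfolding line_closed_def by blast
  moreover have "c *s (y - x) \<in> E" using E subspace_spread vec.subspace_scale by blast
  ultimately show ?thesis by blast
qed

text \<open>Here \<open>q > 2\<close> is needed: the sum \<open>u + v\<close> is the point \<open>c (u / c) + (1 - c) (v / (1 - c))\<close> of
  the line through \<open>u / c\<close> and \<open>v / (1 - c)\<close> for a scalar \<open>c\<close> other than 0 and 1.\<close>

lemma line_closed_imp_translate:
  assumes q: "CARD('a) > 2" and M: "M \<subseteq> H" "line_closed cosets M" and a: "a \<in> M"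
  obtains W where "vec.subspace W" "W \<subseteq> H" "saturated W" "M = (+) a ` W"
proof
  define W where "W = {x. a + x \<in> M}"
  show "M = (+) a ` W"
    by (auto simp: W_def mem_translate_iff)
  have aH: "a \<in> H" using a M by blast
  show "W \<subseteq> H"
  proof
    fix x assume "x \<in> W"
    then have "(a + x) - a \<in> H"
      using M(1) by (intro vec.subspace_diff[OF subspace_H _ aH]) (auto simp: W_def)
    then show "x \<in> H" by simp
  qed
  have scale: "c *s x \<in> W" if "x \<in> W" for c x
    using line_closed_scale_diff[OF M a, of "a + x" c] that by (simp add: W_def)
  obtain c :: 'a where c: "c \<noteq> 0" "c \<noteq> 1"
  proof -
    have "card {0, 1 :: 'a} < CARD('a)" using q by simp
    then have "UNIV \<noteq> {0, 1 :: 'a}" by (metis less_irrefl)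
    then show ?thesis using that by blast
  qed
  have add: "u + v \<in> W" if "u \<in> W" "v \<in> W" for u v
  proof -
    let ?u = "inverse c *s u" and ?v = "inverse (1 - c) *s v"
    have "a + ?v \<in> M" "a + ?u \<in> M" using scale that by (auto simp: W_def)
    then have "(a + ?v) + c *s ((a + ?u) - (a + ?v)) \<in> M"
      using line_closed_scale_diff[OF M] by blast
    moreover have "(a + y) + c *s ((a + x) - (a + y)) = a + (c *s x + (1 - c) *s y)" for x y
      by (simp add: vec.scale_right_diff_distrib vec.scale_left_diff_distrib)
    moreover have "c *s ?u + (1 - c) *s ?v = u + v"
      using c by (simp add: vector_smult_assoc)
    ultimately show ?thesis unfolding W_def mem_Collect_eq by metis
  qed
  show "vec.subspace W"
    using a scale add by (auto simp: vec.subspace_def W_def)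
  show "saturated W"
    unfolding saturated_def
  proof (intro ballI impI)
    fix x E assume x: "x \<in> W" "x \<noteq> 0" "x \<in> E" and E: "E \<in> S"
    have "(+) a ` E \<in> cosets" "a \<in> (+) a ` E" "a + x \<in> (+) a ` E"
      using coset_through_iff[OF aH, of "(+) a ` E"] E x by auto
    moreover have "a \<noteq> a + x" using x by simp
    ultimately have "(+) a ` E \<subseteq> M"
      using M(2) a x(1) unfolding line_closed_def W_def by blast
    then show "E \<subseteq> W" by (auto simp: W_def)
  qed
qed

lemma block_design_translate:
  assumes a: "a \<in> H" and W: "vec.subspace W" "W \<subseteq> H" "saturated W"
  shows "block_design ((+) a ` W) (induced_lines cosets ((+) a ` W)) (card W) (CARD('a) ^ n) 1"
  unfolding block_design_def
proof (intro conjI ballI impI)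
  show "finite ((+) a ` W)" by simp
  show "card ((+) a ` W) = card W" by (simp add: card_image)
  fix b assume b: "b \<in> induced_lines cosets ((+) a ` W)"
  then show "b \<subseteq> (+) a ` W" by (simp add: induced_lines_def)
  show "card b = CARD('a) ^ n"
    using b card_spread by (auto simp: induced_lines_def cosets_def card_image)
next
  fix A B assume AB: "A \<in> (+) a ` W" "B \<in> (+) a ` W" "A \<noteq> B"
  have AH: "A \<in> H" "B \<in> H" using AB a W subspace_H vec.subspace_add by blast+
  then obtain E where E: "E \<in> S" "B - A \<in> E"
    using spread_cover[of "B - A"] AB vec.subspace_diff[OF subspace_H] by auto
  have "{b \<in> induced_lines cosets ((+) a ` W). A \<in> b \<and> B \<in> b} = {(+) A ` E}"
  proof (intro equalityI subsetI)
    fix b assume "b \<in> {b \<in> induced_lines cosets ((+) a ` W). A \<in> b \<and> B \<in> b}"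
    then have "b \<in> cosets \<and> A \<in> b" "B \<in> b" by (auto simp: induced_lines_def)
    then obtain F where F: "F \<in> S" "b = (+) A ` F" using coset_through_iff AH by blast
    then have "B - A \<in> F" using \<open>B \<in> b\<close> by (simp add: mem_translate_iff)
    then have "F = E" using spread_unique[OF F(1) E(1) _ E(2)] AB by auto
    then show "b \<in> {(+) A ` E}" using F by simp
  next
    fix b assume "b \<in> {(+) A ` E}"
    then have b: "b = (+) A ` E" by simp
    then have c: "b \<in> cosets" "A \<in> b" "B \<in> b"
      using coset_through_iff[OF AH(1), of b] E by (auto simp: mem_translate_iff)
    then have "b \<subseteq> (+) a ` W"
      using line_closed_translate[OF a W] AB unfolding line_closed_def by blast
    then show "b \<in> {b \<in> induced_lines cosets ((+) a ` W). A \<in> b \<and> B \<in> b}"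
      using c by (simp add: induced_lines_def)
  qed
  then show "card {b \<in> induced_lines cosets ((+) a ` W). A \<in> b \<and> B \<in> b} = 1" by simp
qed

lemma card_span_spread_pair:
  assumes EF: "E \<in> S" "F \<in> S" "E \<noteq> F"
  shows "card (vec.span (E \<union> F)) = (CARD('a) ^ n)\<^sup>2"
proof -
  have sub: "vec.subspace E" "vec.subspace F" using EF subspace_spread by auto
  have span: "vec.span (E \<union> F) = (\<lambda>(x, y). x + y) ` (E \<times> F)"
    using sub by (auto simp: vec.span_Un vec.span_eq_iff[THEN iffD2] image_iff)
  have "inj_on (\<lambda>(x, y). x + y) (E \<times> F)"
  proof (intro inj_onI, clarify)
    fix x y x' y'
    assume xy: "x \<in> E" "y \<in> F" "x' \<in> E" "y' \<in> F" "x + y = x' + y'"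
    then have eq: "x - x' = y' - y" by (simp add: algebra_simps)
    have "x - x' \<in> E" "x - x' \<in> F"
      using xy vec.subspace_diff sub unfolding eq by (metis eq) (simp add: vec.subspace_diff sub xy)
    then have "x - x' = 0" using spread_unique EF by blast
    then show "x = x' \<and> y = y'" using eq by simp
  qed
  then show ?thesis
    unfolding span using EF
    by (simp add: card_image card_cartesian_product card_spread power2_eq_square)
qed

lemma span_spread_pair_subset: "E \<in> S \<Longrightarrow> F \<in> S \<Longrightarrow> vec.span (E \<union> F) \<subseteq> H"
  using spread_subset subspace_H by (intro vec.span_minimal) auto

lemma saturated_iff_partition:
  assumes W: "vec.subspace W" "W \<subseteq> H"
  shows "(\<exists>T \<subseteq> S. pg_partition W T) \<longleftrightarrow> saturated W"
proof -
  have T: "vec.subspace G \<and> G \<noteq> {0}" if "G \<in> S" for G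
    using subspace_spread[OF that] spread_nonzero[OF that] by blast
  have part: "pg_partition W T \<longleftrightarrow>
      \<Union>T \<subseteq> W \<and> (\<forall>x \<in> W. x \<noteq> 0 \<longrightarrow> (\<exists>!G. G \<in> T \<and> x \<in> G))" if "T \<subseteq> S" for T
    by (rule pg_partition_iff[OF W(1)]) (use T that in blast)
  show ?thesis
  proof
    assume "\<exists>T \<subseteq> S. pg_partition W T"
    then obtain T where TS: "T \<subseteq> S" and "pg_partition W T" by blast
    then have TW: "\<Union>T \<subseteq> W" "\<forall>x \<in> W. x \<noteq> 0 \<longrightarrow> (\<exists>!G. G \<in> T \<and> x \<in> G)"
      using part by simp_all
    show "saturated W"
      unfolding saturated_def
    proof (intro ballI impI)
      fix x E assume x: "x \<in> W" "x \<noteq> 0" "x \<in> E" and E: "E \<in> S"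
      obtain G where G: "G \<in> T" "x \<in> G" using TW(2) x by blast
      have "E = G" by (rule spread_unique[OF E _ x(3) G(2) x(2)]) (use G TS in blast)
      then show "E \<subseteq> W" using TW(1) G by blast
    qed
  next
    assume s: "saturated W"
    have "\<exists>!G. G \<in> {G \<in> S. G \<subseteq> W} \<and> x \<in> G" if x: "x \<in> W" "x \<noteq> 0" for x
    proof -
      obtain G where G: "G \<in> S" "x \<in> G" using spread_cover[of x] x W by blast
      then have "G \<subseteq> W" using s x by (auto simp: saturated_def)
      then show ?thesis
        using spread_unique[OF _ G(1) _ G(2) x(2)] G by (intro ex1I[of _ G]) blast+
    qed
    then have "pg_partition W {G \<in> S. G \<subseteq> W}"
      by (subst part) auto
    then show "\<exists>T \<subseteq> S. pg_partition W T" by (intro exI conjI) auto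
  qed
qed

lemma linear_manifold_triangle:
  assumes q: "CARD('a) > 2" and a: "a \<in> H" and EF: "E \<in> S" "F \<in> S"
    and e: "e \<in> E" "e \<noteq> 0" and f: "f \<in> F" "f \<noteq> 0"
  obtains W where "vec.subspace W" "W \<subseteq> H" "saturated W" "vec.span (E \<union> F) \<subseteq> W"
    "linear_manifold cosets {a, a + e, a + f} = (+) a ` W"
    "saturated (vec.span (E \<union> F)) \<Longrightarrow> W = vec.span (E \<union> F)"
proof -
  let ?M = "linear_manifold cosets {a, a + e, a + f}" and ?V = "vec.span (E \<union> F)"
  have "e \<in> H" "f \<in> H" using e f EF spread_subset by blast+
  then have MH: "?M \<subseteq> H"
    using a vec.subspace_add[OF subspace_H a]
    by (intro linear_manifold_subset[OF cosets_subset]) simp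
  have X: "{a, a + e, a + f} \<subseteq> ?M"
    unfolding linear_manifold_def by (rule hull_subset)
  obtain W where W: "vec.subspace W" "W \<subseteq> H" "saturated W" "?M = (+) a ` W"
    using line_closed_imp_translate[OF q MH line_closed_linear_manifold] X by blast
  have "e \<in> W" "f \<in> W" using X unfolding W(4) by (auto simp: mem_translate_iff)
  then have "E \<subseteq> W" "F \<subseteq> W" using W(3) EF e f by (auto simp: saturated_def)
  then have V: "?V \<subseteq> W" using W(1) by (intro vec.span_minimal) auto
  moreover have "W = ?V" if "saturated ?V"
  proof -
    have "line_closed cosets ((+) a ` ?V)"
      using line_closed_translate[OF a vec.subspace_span span_spread_pair_subset[OF EF] that] .
    moreover have "{a, a + e, a + f} \<subseteq> (+) a ` ?V"
      using e f by (auto simp: mem_translate_iff vec.span_zero intro: vec.span_base)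
    ultimately have "?M \<subseteq> (+) a ` ?V"
      unfolding linear_manifold_def by (intro hull_minimal)
    then have "W \<subseteq> ?V" unfolding W(4) by auto
    then show ?thesis using V by blast
  qed
  ultimately show ?thesis using that[OF W(1-3) _ W(4)] by blast
qed

lemma collinear_in_cosets_iff:
  assumes a: "a \<in> H" and E: "E \<in> S" "e \<in> E" "e \<noteq> 0"
  shows "collinear_in cosets {a, a + e, c} \<longleftrightarrow> c - a \<in> E"
proof
  assume "collinear_in cosets {a, a + e, c}"
  then obtain b where b: "b \<in> cosets" "a \<in> b" "a + e \<in> b" "c \<in> b"
    by (auto simp: collinear_in_def)
  then obtain F where F: "F \<in> S" "b = (+) a ` F" using coset_through_iff[OF a] by blast
  then have "e \<in> F" "c - a \<in> F" using b by (auto simp: mem_translate_iff)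
  then show "c - a \<in> E" using spread_unique E F by blast
next
  assume "c - a \<in> E"
  then have "{a, a + e, c} \<subseteq> (+) a ` E"
    using E subspace_spread vec.subspace_0 by (auto simp: mem_translate_iff)
  then show "collinear_in cosets {a, a + e, c}"
    using coset_through_iff[OF a, of "(+) a ` E"] E by (auto simp: collinear_in_def)
qed

lemma normal_line_cosets_iff:
  assumes q: "CARD('a) > 2" and h: "h \<in> H" and E: "E \<in> S"
  shows "normal_line (CARD('a) ^ n) H cosets ((+) h ` E) \<longleftrightarrow> normal_element S E"
proof -
  have bL: "(+) h ` E \<in> cosets" using h E by (auto simp: cosets_def)
  have "normal_element S E \<longleftrightarrow> (\<forall>F \<in> S - {E}. saturated (vec.span (E \<union> F)))"
  proof -
    have "(\<exists>T \<subseteq> S. pg_partition (vec.span (E \<union> F)) T) \<longleftrightarrow> saturated (vec.span (E \<union> F))"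
      if "F \<in> S - {E}" for F
      by (rule saturated_iff_partition[OF vec.subspace_span span_spread_pair_subset[OF E]])
        (use that in blast)
    then have "(\<forall>F \<in> S - {E}. \<exists>T \<subseteq> S. pg_partition (vec.span (E \<union> F)) T) \<longleftrightarrow>
        (\<forall>F \<in> S - {E}. saturated (vec.span (E \<union> F)))"
      by (intro ball_cong refl)
    then show ?thesis using E by (simp add: normal_element_def)
  qed
  also have "\<dots> \<longleftrightarrow> normal_line (CARD('a) ^ n) H cosets ((+) h ` E)"
  proof
    assume sat: "\<forall>F \<in> S - {E}. saturated (vec.span (E \<union> F))"
    have "is_affine_plane (CARD('a) ^ n) cosets M"
      if M: "pseudo_plane_through H cosets ((+) h ` E) M" for M
    proof -
      obtain A B C where ABC: "A \<in> (+) h ` E" "B \<in> (+) h ` E" "A \<noteq> B" "C \<in> H"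
          "\<not> collinear_in cosets {A, B, C}" "M = linear_manifold cosets {A, B, C}"
        using M unfolding pseudo_plane_through_def by blast
      have A: "A \<in> H" using cosets_subset bL ABC by blast
      have e: "B - A \<in> E" "B - A \<noteq> 0"
        using ABC(2,3) unfolding coset_eq[OF subspace_spread[OF E] ABC(1)]
        by (auto simp: mem_translate_iff)
      have C: "C - A \<notin> E"
        using collinear_in_cosets_iff[OF A E e, of C] ABC(5) by simp
      then have C0: "C - A \<noteq> 0"
        using vec.subspace_0[OF subspace_spread[OF E]] by metis
      obtain F where F: "F \<in> S" "C - A \<in> F"
        using spread_cover[OF vec.subspace_diff[OF subspace_H ABC(4) A] C0] by blast
      have "E \<noteq> F" using F C by blast
      then have V: "saturated (vec.span (E \<union> F))" using sat F by blast
      obtain W where W: "vec.subspace W" "W \<subseteq> H" "saturated W" "W = vec.span (E \<union> F)"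
          "linear_manifold cosets {A, A + (B - A), A + (C - A)} = (+) A ` W"
        by (rule linear_manifold_triangle[OF q A E F(1) e F(2) C0]) (use V in blast)
      have M: "M = (+) A ` W" using W(5) ABC(6) by simp
      show ?thesis
        using block_design_translate[OF A W(1-3)] card_span_spread_pair[OF E F(1) \<open>E \<noteq> F\<close>]
        unfolding is_affine_plane_def M W(4) by simp
    qed
    then show "normal_line (CARD('a) ^ n) H cosets ((+) h ` E)"
      using bL by (simp add: normal_line_def)
  next
    assume norm: "normal_line (CARD('a) ^ n) H cosets ((+) h ` E)"
    show "\<forall>F \<in> S - {E}. saturated (vec.span (E \<union> F))"
    proof
      fix F assume "F \<in> S - {E}"
      then have F: "F \<in> S" "E \<noteq> F" by auto
      obtain e where e: "e \<in> E" "e \<noteq> 0" using spread_nonzero[OF E] .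
      obtain f where f: "f \<in> F" "f \<noteq> 0" using spread_nonzero[OF F(1)] .
      have "f \<notin> E" using spread_unique E F f by blast
      then have "\<not> collinear_in cosets {h, h + e, h + f}"
        using collinear_in_cosets_iff[OF h E e] by simp
      moreover have "h \<in> (+) h ` E" "h + e \<in> (+) h ` E" "h \<noteq> h + e"
        using e subspace_spread[OF E] vec.subspace_0 by (auto simp: mem_translate_iff)
      moreover have "h + f \<in> H"
        using f F spread_subset h subspace_H vec.subspace_add by blast
      ultimately have "pseudo_plane_through H cosets ((+) h ` E)
          (linear_manifold cosets {h, h + e, h + f})"
        unfolding pseudo_plane_through_def by blast
      then have "is_affine_plane (CARD('a) ^ n) cosets (linear_manifold cosets {h, h + e, h + f})"
        using norm by (simp add: normal_line_def)
      then have card: "card (linear_manifold cosets {h, h + e, h + f}) = (CARD('a) ^ n)\<^sup>2"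
        by (simp add: is_affine_plane_def block_design_def)
      obtain W where W: "saturated W" "vec.span (E \<union> F) \<subseteq> W"
          "linear_manifold cosets {h, h + e, h + f} = (+) h ` W"
        by (rule linear_manifold_triangle[OF q h E F(1) e f])
      have "card W = card (vec.span (E \<union> F))"
        using card card_span_spread_pair[OF E F] by (simp add: W(3) card_image)
      then have "vec.span (E \<union> F) = W"
        using W(2) by (intro card_subset_eq) auto
      then show "saturated (vec.span (E \<union> F))" using W(1) by simp
    qed
  qed
  finally show ?thesis ..
qed

end

section \<open>Affine coordinates\<close>

locale hyperplane_spread = vector_spread H S n
  for H :: "('a::{field,finite} ^ 'd) set" and S n +
  fixes w :: "'a ^ 'd"
  assumes w_notin: "w \<notin> H" and dim_H: "Suc (vec.dim H) = CARD('d)"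
begin

definition point :: "'a ^ 'd \<Rightarrow> ('a ^ 'd) set" where
  "point h = vec.span {w + h}"

lemma not_in_H_iff: "h \<in> H \<Longrightarrow> w + h \<notin> H"
  using w_notin vec.subspace_diff[OF subspace_H, of "w + h" h] by auto

lemma point_subset_iff: "vec.subspace U \<Longrightarrow> point h \<subseteq> U \<longleftrightarrow> w + h \<in> U"
  unfolding point_def using vec.span_base[of "w + h" "{w + h}"] vec.span_minimal[of "{w + h}" U]
  by blast

lemma normalise:
  assumes "x \<notin> H"
  obtains c h where "c \<noteq> 0" "h \<in> H" "x = c *s (w + h)"
proof -
  have "vec.dim (insert w H) = CARD('d)"
    using w_notin dim_H subspace_H by (simp add: vec.dim_insert vec.span_eq_iff[THEN iffD2])
  then have "vec.span (insert w H) = UNIV"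
    using vec.dim_eq_full[of "insert w H"] by (simp add: vec.dimension_def card_cart_basis)
  then obtain c where "x - c *s w \<in> vec.span H"
    by (metis UNIV_I vec.span_breakdown_eq)
  then have c: "x - c *s w \<in> H" using subspace_H by (simp add: vec.span_eq_iff[THEN iffD2])
  have c0: "c \<noteq> 0" using c assms by auto
  show ?thesis
  proof (rule that[OF c0, of "inverse c *s (x - c *s w)"])
    show "inverse c *s (x - c *s w) \<in> H" using c subspace_H vec.subspace_scale by blast
    show "x = c *s (w + inverse c *s (x - c *s w))"
      using c0 by (simp add: vec.scale_right_distrib vector_smult_assoc)
  qed
qed

lemma inj_point: "inj_on point H"
proof (rule inj_onI)
  fix h h' assume h: "h \<in> H" "h' \<in> H" "point h = point h'"
  then have "w + h \<in> vec.span {w + h'}"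
    using vec.span_base[of "w + h" "{w + h}"] by (simp add: point_def)
  then obtain c where c: "w + h = c *s (w + h')" by (auto simp: vec.span_singleton)
  have "(1 - c) *s w = c *s h' - h"
    using c by (simp add: vec.scale_left_diff_distrib vec.scale_right_distrib algebra_simps)
  then have "(1 - c) *s w \<in> H"
    using h subspace_H by (simp add: vec.subspace_diff vec.subspace_scale)
  then have "1 - c = 0"
    using w_notin vec.subspace_scale[OF subspace_H, of "(1 - c) *s w" "inverse (1 - c)"]
    by (cases "1 - c = 0") (auto simp: vector_smult_assoc)
  then show "h = h'" using c by simp
qed

lemma ts_points_eq: "ts_points H = point ` H"
proof (intro set_eqI iffI)
  fix P assume "P \<in> ts_points H"
  then obtain x where x: "x \<noteq> 0" "P = vec.span {x}" "P \<notin> pg_points H"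
    unfolding ts_points_def by (auto simp: pg_points_eq[OF vec.subspace_UNIV])
  then have "x \<notin> H" using span_singleton_in_pg_points_iff[OF subspace_H] by blast
  then obtain c h where c: "c \<noteq> 0" "h \<in> H" "x = c *s (w + h)" by (rule normalise)
  have "P = point h"
  proof
    show "P \<subseteq> point h"
      unfolding x(2) c(3) point_def
      by (rule vec.span_minimal) (auto intro: vec.span_scale vec.span_base)
    have "inverse c *s x \<in> P"
      unfolding x(2) by (intro vec.span_scale vec.span_base) simp
    then have "w + h \<in> P" using c by (simp add: vector_smult_assoc)
    then show "point h \<subseteq> P" using point_subset_iff x(2) vec.subspace_span by metis
  qed
  then show "P \<in> point ` H" using c by blast
next
  fix P assume "P \<in> point ` H"
  then obtain h where h: "h \<in> H" "P = point h" by blast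
  then have "w + h \<notin> H" using not_in_H_iff by blast
  moreover from this have "w + h \<noteq> 0" using vec.subspace_0[OF subspace_H] by auto
  ultimately show "P \<in> ts_points H"
    using h span_singleton_in_pg_points_iff[OF subspace_H] span_singleton_in_pg_points_iff[OF vec.subspace_UNIV]
    by (simp add: ts_points_def point_def)
qed

lemma ts_line_eq:
  assumes U: "vec.subspace U" and h: "h \<in> H" "w + h \<in> U"
  shows "ts_line H U = point ` ((+) h ` (U \<inter> H))"
proof -
  have "k \<in> (+) h ` (U \<inter> H) \<longleftrightarrow> w + k \<in> U" if k: "k \<in> H" for k
  proof -
    have "k - h \<in> H" using k h vec.subspace_diff[OF subspace_H] by blast
    moreover have "k - h \<in> U \<longleftrightarrow> w + k \<in> U"
      using vec.subspace_diff[OF U _ h(2), of "w + k"] vec.subspace_add[OF U _ h(2), of "k - h"]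
      by (auto simp: algebra_simps)
    ultimately show ?thesis by (simp add: mem_translate_iff)
  qed
  moreover have "(+) h ` (U \<inter> H) \<subseteq> H"
    using h vec.subspace_add[OF subspace_H] by blast
  ultimately have "(+) h ` (U \<inter> H) = {k \<in> H. w + k \<in> U}" by blast
  then show ?thesis
    using point_subset_iff[OF U] by (auto simp: ts_line_def ts_points_eq)
qed

lemma ts_space_base:
  assumes "U \<in> ts_spaces n H S"
  obtains h where "h \<in> H" "w + h \<in> U"
proof -
  have U: "vec.subspace U" "vec.dim U = Suc n" "U \<inter> H \<in> S"
    using assms by (auto simp: ts_spaces_def pg_subspaces_def)
  have "\<not> U \<subseteq> H"
    using U dim_spread[OF U(3)] by (metis inf.absorb1 n_not_Suc_n)
  then obtain x where x: "x \<in> U" "x \<notin> H" by blast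
  from x(2) obtain c h where c: "c \<noteq> 0" "h \<in> H" "x = c *s (w + h)" by (rule normalise)
  have "inverse c *s x \<in> U" using x U vec.subspace_scale by blast
  then have "w + h \<in> U" using c by (simp add: vector_smult_assoc)
  then show ?thesis using that c by blast
qed

lemma ts_space_exists:
  assumes E: "E \<in> S" and h: "h \<in> H"
  obtains U where "U \<in> ts_spaces n H S" "w + h \<in> U" "U \<inter> H = E"
proof -
  let ?U = "vec.span (insert (w + h) E)"
  have sp: "vec.span E = E" using subspace_spread[OF E] by (simp add: vec.span_eq_iff)
  have "w + h \<notin> E" using not_in_H_iff[OF h] spread_subset[OF E] by blast
  then have dim: "vec.dim ?U = Suc n"
    using dim_spread[OF E] by (simp add: vec.dim_insert sp)
  have "?U \<inter> H = E"
  proof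
    show "E \<subseteq> ?U \<inter> H" using spread_subset[OF E] vec.span_superset[of "insert (w + h) E"] by blast
    show "?U \<inter> H \<subseteq> E"
    proof
      fix x assume x: "x \<in> ?U \<inter> H"
      then obtain c where c: "x - c *s (w + h) \<in> E" by (auto simp: vec.span_breakdown_eq sp)
      then have "x - (x - c *s (w + h)) \<in> H"
        using x spread_subset[OF E] vec.subspace_diff[OF subspace_H] by blast
      then have cH: "c *s (w + h) \<in> H" by simp
      have "c = 0"
      proof (rule ccontr)
        assume "c \<noteq> 0"
        then have "w + h = inverse c *s (c *s (w + h))" by (simp add: vector_smult_assoc)
        then show False
          using cH vec.subspace_scale[OF subspace_H] not_in_H_iff[OF h] by metis
      qed
      then show "x \<in> E" using c by simp
    qed
  qed
  moreover from this have "?U \<in> ts_spaces n H S"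
    using dim E by (simp add: ts_spaces_def pg_subspaces_def)
  moreover have "w + h \<in> ?U" by (simp add: vec.span_base)
  ultimately show ?thesis using that by blast
qed

lemma ts_lines_eq: "ts_lines n H S = (`) point ` cosets"
proof (intro set_eqI iffI)
  fix l assume "l \<in> ts_lines n H S"
  then obtain U where U: "U \<in> ts_spaces n H S" "l = ts_line H U" by (auto simp: ts_lines_def)
  then obtain h where "h \<in> H" "w + h \<in> U" by (elim ts_space_base)
  moreover have "vec.subspace U" "U \<inter> H \<in> S" using U by (auto simp: ts_spaces_def pg_subspaces_def)
  ultimately show "l \<in> (`) point ` cosets"
    using U(2) ts_line_eq by (auto simp: cosets_def)
next
  fix l assume "l \<in> (`) point ` cosets"
  then obtain h E where h: "h \<in> H" "E \<in> S" "l = point ` ((+) h ` E)" by (auto simp: cosets_def)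
  then obtain U where U: "U \<in> ts_spaces n H S" "w + h \<in> U" "U \<inter> H = E" by (elim ts_space_exists)
  then have "l = ts_line H U"
    using h ts_line_eq[of U h] by (simp add: ts_spaces_def pg_subspaces_def)
  then show "l \<in> ts_lines n H S" using U by (auto simp: ts_lines_def)
qed

lemma normal_ts_line_iff:
  assumes q: "CARD('a) > 2" and U: "U \<in> ts_spaces n H S"
  shows "normal_line (CARD('a) ^ n) (ts_points H) (ts_lines n H S) (ts_line H U)
    \<longleftrightarrow> normal_element S (U \<inter> H)"
proof -
  obtain h where h: "h \<in> H" "w + h \<in> U" using ts_space_base[OF U] .
  have U': "vec.subspace U" "U \<inter> H \<in> S"
    using U by (auto simp: ts_spaces_def pg_subspaces_def)
  have b: "(+) h ` (U \<inter> H) \<in> cosets" using h U' by (auto simp: cosets_def)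
  show ?thesis
    unfolding ts_points_eq ts_lines_eq ts_line_eq[OF U'(1) h]
      normal_line_image[OF inj_point cosets_subset b]
    by (rule normal_line_cosets_iff[OF q h(1) U'(2)])
qed

end

lemma pg_spread_imp_vector_spread:
  fixes H :: "('a::{field,finite} ^ 'd) set"
  assumes n: "0 < n" and H: "vec.subspace H" and S: "pg_spread (n - 1) H S"
  shows "vector_spread H S n"
proof -
  have S': "vec.subspace E" "E \<subseteq> H" "vec.dim E = n" if "E \<in> S" for E
    using S n that by (auto simp: pg_spread_def pg_subspaces_def)
  have "E \<noteq> {0}" if "E \<in> S" for E using S'(3)[OF that] n by auto
  then have part: "\<forall>x \<in> H. x \<noteq> 0 \<longrightarrow> (\<exists>!G. G \<in> S \<and> x \<in> G)"
    using S pg_partition_iff[OF H, of S] S'(1) by (simp add: pg_spread_def)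
  show ?thesis
  proof
    show "\<exists>E \<in> S. x \<in> E" if "x \<in> H" "x \<noteq> 0" for x using part that by blast
    show "E = F" if "E \<in> S" "F \<in> S" "x \<in> E" "x \<in> F" "x \<noteq> 0" for E F x
      using part that S'(2) by blast
  qed (use n H S' in auto)
qed

theorem theorem7p4:
  fixes H U :: "('a::{field,finite} ^ 'd) set"
    and S :: "('a ^ 'd) set set"
    and n r :: nat
  assumes "n \<ge> 1" and "r \<ge> 1"
    and "CARD('a) > 2"
    and "CARD('d) = r * n + 1"
    and "H \<in> pg_subspaces (r * n - 1) UNIV"
    and "pg_spread (n - 1) H S"
    and "U \<in> ts_spaces n H S"
  shows "normal_line (CARD('a) ^ n) (ts_points H) (ts_lines n H S) (ts_line H U)
           \<longleftrightarrow> normal_element S (U \<inter> H)"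
proof -
  have H: "vec.subspace H" "Suc (vec.dim H) = CARD('d)"
    using assms(1,2,4,5) by (auto simp: pg_subspaces_def)
  have "H \<noteq> UNIV" using H(2) vec_dim_card[where 'a='a and 'n='d] by auto
  then obtain w where w: "w \<notin> H" by blast
  interpret vector_spread H S n
    by (rule pg_spread_imp_vector_spread[OF _ H(1) assms(6)]) (use assms(1) in simp)
  interpret hyperplane_spread H S n w
    by unfold_locales (use w H in auto)
  show ?thesis using normal_ts_line_iff[OF assms(3,7)] .
qed

end
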